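(* Let $k\ge 1$ be an integer and let $\alpha\in\{0,1,\dots,k-1\}$. For $n\ge 0$ put $G^{(k;\alpha)}_n := F_{kn+\alpha}$. Then for every $n\ge 1$ $$G^{(k;\alpha)}_{n+1}=L_k\,G^{(k;\alpha)}_n+(-1)^{k-1}\,G^{(k;\alpha)}_{n-1},$$ where $L_k$ is the $k$-th Lucas number. Consequently, the sequence is given by generalized Fibonacci polynomials with integer arguments: for every $n\ge 0$, $$G^{(k;\alpha)}_n=F_{kn+\alpha}=G_n\bigl(L_k,(-1)^{k-1}\bigr),$$ where $G_n(p,q)$ are the generalized Fibonacci polynomials with initial values $G_0=F_\alpha$ and $G_1=F_{\alpha+k}$.
   Context: The Fibonacci numbers are $F_0=0$, $F_1=1$, $F_{n+1}=F_n+F_{n-1}$. The Lucas numbers are $L_n=\varphi^n+\varphi'^n$, where $\varphi=\frac{1+\sqrt5}{2}$ and $\varphi'=\frac{1-\sqrt5}{2}$. Given initial values $G_0,G_1$, the generalized Fibonacci polynomials $G_n(p,q)$ are defined by $G_0(p,q)=G_0$, $G_1(p,q)=G_1$ and $G_{n+1}(p,q)=p\,G_n(p,q)+q\,G_{n-1}(p,q)$ for $n\ge 1$. *)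

theory Defs
  imports Complex_Main "HOL-Number_Theory.Fib"
begin

definition phi :: real where
  "phi = (1 + sqrt 5) / 2"

definition phi' :: real where
  "phi' = (1 - sqrt 5) / 2"

definition lucas :: "nat \<Rightarrow> real" where
  "lucas n = phi ^ n + phi' ^ n"

(* gen_fib_poly G0 G1 n p q is the value at (p, q) of the n-th generalized Fibonacci
   polynomial with initial values G0 and G1.  The coefficient ring is arbitrary, so the
   formal polynomials are obtained by taking p and q to be indeterminates. *)
fun gen_fib_poly :: "'a::comm_ring_1 \<Rightarrow> 'a \<Rightarrow> nat \<Rightarrow> 'a \<Rightarrow> 'a \<Rightarrow> 'a" where
  "gen_fib_poly G0 G1 0 p q = G0"
| "gen_fib_poly G0 G1 (Suc 0) p q = G1"
| "gen_fib_poly G0 G1 (Suc (Suc n)) p q =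
     p * gen_fib_poly G0 G1 (Suc n) p q + q * gen_fib_poly G0 G1 n p q"

definition fib_prog :: "nat \<Rightarrow> nat \<Rightarrow> nat \<Rightarrow> nat" where
  "fib_prog k \<alpha> n = fib (k * n + \<alpha>)"

end

(* By Binet's formula, m \<mapsto> fib m is a combination of phi ^ m and phi' ^ m.  Hence stepping the
   index by k gives a sequence whose characteristic roots are phi ^ k and phi' ^ k, with sum
   lucas k and product (phi * phi') ^ k = (-1) ^ k. *)
theory Submission imports Defs begin

lemma phi_mult_phi': "phi * phi' = -1"
  by (simp add: phi_def phi'_def field_simps)

lemma phi_power2: "phi ^ 2 = phi + 1"
  by (simp add: phi_def power2_eq_square field_simps)

lemma phi'_power2: "phi' ^ 2 = phi' + 1"
  by (simp add: phi'_def power2_eq_square field_simps)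

lemma power_Suc_Suc_eq_add:
  fixes x :: "'a::comm_semiring_1"
  assumes "x ^ 2 = x + 1"
  shows "x ^ Suc (Suc n) = x ^ Suc n + x ^ n"
proof -
  have "x ^ Suc (Suc n) = x ^ 2 * x ^ n"
    by (simp add: power2_eq_square mult.assoc)
  then show ?thesis
    by (simp add: assms distrib_right)
qed

lemmas phi_power_Suc_Suc = power_Suc_Suc_eq_add[OF phi_power2]
lemmas phi'_power_Suc_Suc = power_Suc_Suc_eq_add[OF phi'_power2]

text \<open>Powers of \<open>phi\<close> and \<open>phi'\<close> obey the Fibonacci recurrence,
  hence so does their sum; it starts with the integers 2 and 1. This justifies calling the arguments
  of the polynomials integers although \<open>lucas\<close> is real-valued.\<close>

lemma lucas_Ints: "lucas n \<in> \<int>"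
proof (induction n rule: fib.induct)
  case 1
  then show ?case by (simp add: lucas_def)
next
  case 2
  then show ?case by (simp add: lucas_def phi_def phi'_def field_simps)
next
  case (3 n)
  have "lucas (Suc (Suc n)) = lucas (Suc n) + lucas n"
    unfolding lucas_def phi_power_Suc_Suc phi'_power_Suc_Suc by simp
  then show ?case using 3 by simp
qed

text \<open>Both \<open>phi ^ k\<close> and \<open>phi' ^ k\<close> are roots of t^2 =
  \<open>lucas k\<close> * t - (-1)^k. Multiply by \<open>phi ^ m\<close> and
  \<open>phi' ^ m\<close> respectively, subtract, and divide by \<open>sqrt 5\<close>.\<close>

lemma fib_add_twice:
  "real (fib (m + 2 * k)) = lucas k * real (fib (m + k)) - (-1) ^ k * real (fib m)"
proof -
  have "phi ^ k * phi' ^ k = (-1) ^ k"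
    by (simp add: phi_mult_phi' flip: power_mult_distrib)
  then show ?thesis
    unfolding fib_closed_form[folded phi_def phi'_def] lucas_def mult_2 power_add
    \<comment> \<open>Replacing the sign by the product of the two powers leaves a pure ring
      identity.\<close>
    by (simp add: field_simps flip: \<open>phi ^ k * phi' ^ k = (-1) ^ k\<close>)
qed

lemma fib_prog_Suc_Suc:
  assumes "k \<ge> 1"
  shows "real (fib_prog k \<alpha> (Suc (Suc n))) =
    lucas k * real (fib_prog k \<alpha> (Suc n)) + (-1) ^ (k - 1) * real (fib_prog k \<alpha> n)"
proof -
  \<comment> \<open>Here k \<ge> 1 matters: on naturals \<open>0 - 1\<close> is 0, so the sign would
    not flip at k = 0.\<close>
  have "(-1) ^ k = - ((-1) ^ (k - 1) :: real)"
    using assms by (cases k) auto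
  then show ?thesis
    using fib_add_twice[of "k * n + \<alpha>" k] by (simp add: fib_prog_def mult_2_right algebra_simps)
qed

lemma fib_prog_eq_gen_fib_poly:
  assumes "k \<ge> 1"
  shows "real (fib_prog k \<alpha> n) =
    gen_fib_poly (real (fib \<alpha>)) (real (fib (\<alpha> + k))) n (lucas k) ((-1) ^ (k - 1))"
\<comment> \<open>This two-step induction matches the recursion of \<open>gen_fib_poly\<close>; its
  base cases are the indices \<alpha> and k + \<alpha>.\<close>
proof (induction n rule: fib.induct)
  case (3 n)
  then show ?case by (simp only: fib_prog_Suc_Suc[OF assms] gen_fib_poly.simps)
qed (simp_all add: fib_prog_def add.commute)

theorem theorem1:
  fixes k \<alpha> :: nat
  assumes "k \<ge> 1" and "\<alpha> \<in> {0..<k}"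
  shows "(\<forall>n\<ge>1. real (fib_prog k \<alpha> (n + 1)) =
            lucas k * real (fib_prog k \<alpha> n) + (-1) ^ (k - 1) * real (fib_prog k \<alpha> (n - 1)))
       \<and> lucas k \<in> \<int>
       \<and> (\<forall>n. fib_prog k \<alpha> n = fib (k * n + \<alpha>)
            \<and> real (fib (k * n + \<alpha>)) =
                gen_fib_poly (real (fib \<alpha>)) (real (fib (\<alpha> + k))) n (lucas k) ((-1) ^ (k - 1)))"
proof (intro conjI allI impI)
  fix n :: nat
  assume "n \<ge> 1"
  then show "real (fib_prog k \<alpha> (n + 1)) =
      lucas k * real (fib_prog k \<alpha> n) + (-1) ^ (k - 1) * real (fib_prog k \<alpha> (n - 1))"
    \<comment> \<open>For n \<ge> 1, \<open>Suc (Suc (n - 1))\<close> is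
      \<open>n + 1\<close>.\<close>
    using fib_prog_Suc_Suc[OF assms(1), of \<alpha> "n - 1"] by simp
next
  show "lucas k \<in> \<int>"
    by (rule lucas_Ints)
next
  fix n
  show "fib_prog k \<alpha> n = fib (k * n + \<alpha>)"
    by (rule fib_prog_def)
  show "real (fib (k * n + \<alpha>)) =
      gen_fib_poly (real (fib \<alpha>)) (real (fib (\<alpha> + k))) n (lucas k) ((-1) ^ (k - 1))"
    using fib_prog_eq_gen_fib_poly[OF assms(1)] by (simp add: fib_prog_def)
qed

end
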